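(* Let $n,k,t$ be positive integers with $t\geq 2$, and let $\mathcal{F}\subset\binom{[n]}{k}$ be a $t$-intersecting family. If $|\mathcal{F}|>(t+1)\binom{n-1}{k-t-1}$ and $n\geq 2t(t+2)k$, then $\varrho(\mathcal{F})>\frac{t}{t+1}$.
   Context: $[n]=\{1,\ldots,n\}$ and $\binom{[n]}{k}$ is the collection of all $k$-element subsets of $[n]$. A family $\mathcal{F}$ is $t$-intersecting if $|F\cap F'|\geq t$ for all $F,F'\in\mathcal{F}$ (including $F=F'$). For $i\in[n]$ put $\mathcal{F}(i)=\{F\setminus\{i\}: i\in F\in\mathcal{F}\}$, and for nonempty $\mathcal{F}$ put $\varrho(\mathcal{F})=\max_{1\leq i\leq n}|\mathcal{F}(i)|/|\mathcal{F}|$. Binomial coefficients with negative lower index are $0$. *)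

theory Defs
  imports Complex_Main "HOL-Library.Ramsey"
begin

text \<open>The case \<open>F = F'\<close> is included, so every member has at least \<open>t\<close> elements (members are
  understood to be finite).\<close>

definition t_intersecting :: "nat \<Rightarrow> 'a set set \<Rightarrow> bool" where
  "t_intersecting t \<F> \<longleftrightarrow> (\<forall>F\<in>\<F>. \<forall>F'\<in>\<F>. t \<le> card (F \<inter> F'))"

definition link :: "'a set set \<Rightarrow> 'a \<Rightarrow> 'a set set" where
  "link \<F> i = {F - {i} | F. F \<in> \<F> \<and> i \<in> F}"

text \<open>Only meaningful for \<open>n \<ge> 1\<close> and finite nonempty \<open>\<F>\<close>.\<close>

definition varrho :: "nat \<Rightarrow> nat set set \<Rightarrow> real" where
  "varrho n \<F> = Max ((\<lambda>i. real (card (link \<F> i)) / real (card \<F>)) ` {1..n})"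

text \<open>The lower index is an integer: with natural numbers, \<open>k - t - 1\<close> would be truncated to \<open>0\<close>
  for \<open>k \<le> t\<close>, giving the value \<open>1\<close> instead of \<open>0\<close>.\<close>

definition int_binomial :: "nat \<Rightarrow> int \<Rightarrow> nat" where
  "int_binomial n j = (if j < 0 then 0 else n choose nat j)"

end

theory Submission
  imports Defs
begin

text \<open>
  Write \<open>F(x)\<close> for the link of \<open>x\<close>, \<open>F(\<not>x)\<close> for the members avoiding \<open>x\<close>, and \<open>M\<close> for the
  binomial coefficient \<open>(n-1 choose k-t-1)\<close>. The proof rests on a dichotomy: in a \<open>t\<close>-intersecting
  family, for every point \<open>x\<close>, one of \<open>F(x)\<close> and \<open>F(\<not>x)\<close> has at most \<open>M\<close> members
  (\<open>small_link_or_deletion\<close>). So degrees have a gap. If every degree is at most \<open>t/(t+1) |F|\<close>, then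
  each \<open>F(\<not>x)\<close> has at least \<open>|F|/(t+1) > M\<close> members, and hence all degrees are in fact at most \<open>M\<close>.

  The gap makes this situation stable under the compressions replacing a point \<open>j\<close> by a smaller
  point \<open>i\<close>. A compression adds at most one old degree to another, so afterwards all degrees are at
  most \<open>2M \<le> tM < t/(t+1) |F|\<close>, and by the dichotomy they are again at most \<open>M\<close>; it is here that
  \<open>t \<ge> 2\<close> enters. After finitely many compressions the family is shifted. In a shifted family the
  members avoiding the least point are \<open>(t+1)\<close>-intersecting, so there are at most \<open>M\<close> of them;
  together with the at most \<open>M\<close> members containing that point this gives \<open>|F| \<le> 2M\<close>, a
  contradiction (\<open>small_links_bound\<close>).

  Both size estimates are instances of one inequality for a pair of cross-\<open>t\<close>-intersecting
  families \<open>A\<close>, \<open>B\<close> of \<open>a\<close>-sets and \<open>b\<close>-sets on \<open>m\<close> points (\<open>cross_intersecting_bound\<close>): if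
  \<open>u + v = 2t + 1\<close>, then \<open>|A| \<le> (m choose a-u)\<close> or \<open>|B| \<le> (m choose b-v)\<close>. The dichotomy is the
  case \<open>A = F(x)\<close>, \<open>B = F(\<not>x)\<close>, \<open>a = k-1\<close>, \<open>b = k\<close>, \<open>u = t\<close>, \<open>v = t+1\<close>, where the two bounds agree.
\<close>

section \<open>Compressions\<close>

definition shift_set :: "nat \<Rightarrow> nat \<Rightarrow> nat set \<Rightarrow> nat set" where
  "shift_set i j F = (if j \<in> F \<and> i \<notin> F then insert i (F - {j}) else F)"

text \<open>The compression moves a member only if its image is not already present; this is what makes it
  injective on the family, so that it preserves the number of members.\<close>

definition shift_in :: "nat \<Rightarrow> nat \<Rightarrow> nat set set \<Rightarrow> nat set \<Rightarrow> nat set" where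
  "shift_in i j A F = (if shift_set i j F \<in> A then F else shift_set i j F)"

definition shift :: "nat \<Rightarrow> nat \<Rightarrow> nat set set \<Rightarrow> nat set set" where
  "shift i j A = shift_in i j A ` A"

definition shifted_on :: "nat set \<Rightarrow> nat set set \<Rightarrow> bool" where
  "shifted_on X A \<longleftrightarrow>
    (\<forall>F\<in>A. \<forall>i\<in>X. \<forall>j\<in>X. i < j \<and> j \<in> F \<and> i \<notin> F \<longrightarrow> insert i (F - {j}) \<in> A)"

text \<open>Set sizes and intersection sizes are measured by integers here and in \<open>uniform_on\<close>, so that
  inductions can pass from \<open>a\<close> and \<open>t\<close> to \<open>a - 1\<close> and \<open>t - 1\<close> without exceptional cases at \<open>0\<close>.\<close>

definition cross_intersecting :: "int \<Rightarrow> 'a set set \<Rightarrow> 'a set set \<Rightarrow> bool" where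
  "cross_intersecting t A B \<longleftrightarrow> (\<forall>F\<in>A. \<forall>G\<in>B. t \<le> int (card (F \<inter> G)))"

definition uniform_on :: "'a set \<Rightarrow> int \<Rightarrow> 'a set set \<Rightarrow> bool" where
  "uniform_on X a A \<longleftrightarrow> (\<forall>F\<in>A. F \<subseteq> X \<and> int (card F) = a)"

lemma uniform_on_finite: "finite X \<Longrightarrow> uniform_on X a A \<Longrightarrow> finite A"
  by (rule finite_subset[of A "Pow X"]) (auto simp: uniform_on_def)

lemma shift_set_inj:
  assumes "shift_set i j F = shift_set i j G" "shift_set i j F \<noteq> F" "shift_set i j G \<noteq> G"
  shows "F = G"
proof -
  have "j \<in> F" "i \<notin> F" "j \<in> G" "i \<notin> G"
    using assms(2,3) by (auto simp: shift_set_def split: if_splits)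
  then have FG: "F = insert j (shift_set i j F - {i})" "insert j (shift_set i j G - {i}) = G"
    by (auto simp: shift_set_def)
  note FG(1)
  also have "insert j (shift_set i j F - {i}) = insert j (shift_set i j G - {i})"
    by (simp only: assms(1))
  also note FG(2)
  finally show ?thesis .
qed

lemma inj_on_shift_in: "inj_on (shift_in i j A) A"
proof (rule inj_onI)
  fix F G assume "F \<in> A" "G \<in> A" "shift_in i j A F = shift_in i j A G"
  then show "F = G"
    using shift_set_inj[of i j F G] unfolding shift_in_def by (metis (full_types))
qed

lemma card_shift: "card (shift i j A) = card A"
  unfolding shift_def by (rule card_image[OF inj_on_shift_in])

lemma card_shift_set:
  assumes "finite F" shows "card (shift_set i j F) = card F"
proof (cases "j \<in> F \<and> i \<notin> F")
  case True
  then have "card (shift_set i j F) = Suc (card (F - {j}))"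
    using assms by (simp add: shift_set_def)
  also have "\<dots> = card F" using True assms by (simp only: card_Suc_Diff1)
  finally show ?thesis .
qed (auto simp: shift_set_def)

lemma uniform_on_shift:
  assumes "uniform_on X a A" "finite X" "i \<in> X"
  shows "uniform_on X a (shift i j A)"
  unfolding uniform_on_def
proof
  fix H assume "H \<in> shift i j A"
  then obtain F where F: "F \<in> A" "H = F \<or> H = shift_set i j F"
    by (auto simp: shift_def shift_in_def split: if_splits)
  have FX: "F \<subseteq> X" "int (card F) = a" using assms(1) F(1) by (auto simp: uniform_on_def)
  then have "finite F" using assms(2) finite_subset by blast
  moreover have "shift_set i j F \<subseteq> X" using FX assms(3) by (auto simp: shift_set_def)
  ultimately show "H \<subseteq> X \<and> int (card H) = a"
    using F(2) FX card_shift_set by auto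
qed

lemma cross_intersecting_commute: "cross_intersecting t A B \<longleftrightarrow> cross_intersecting t B A"
  unfolding cross_intersecting_def by (metis Int_commute)

text \<open>The critical case of \<open>cross_intersecting_shift\<close>. Moving \<open>F\<close> can lose a common point only if \<open>G\<close>
  contains \<open>j\<close> and not \<open>i\<close>. But \<open>G\<close> stayed in place because its compression \<open>G'\<close> is also in \<open>B\<close>, and
  \<open>F\<close> meets \<open>G'\<close> in exactly the points in which the moved \<open>F\<close> meets \<open>G\<close>.\<close>

lemma moved_meets_unmoved:
  assumes cr: "cross_intersecting t A B"
    and F: "F \<in> A" "finite F" "j \<in> F" "i \<notin> F"
    and G: "G \<in> B" "shift_set i j G \<in> B"
  shows "t \<le> int (card (insert i (F - {j}) \<inter> G))"
proof (cases "j \<in> G \<and> i \<notin> G")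
  case True
  then have "insert i (F - {j}) \<inter> G = F \<inter> shift_set i j G"
    using F by (auto simp: shift_set_def)
  then show ?thesis using cr F(1) G(2) by (simp add: cross_intersecting_def)
next
  case False
  have "card (F \<inter> G) \<le> card (insert i (F - {j}) \<inter> G)"
  proof (cases "j \<in> G")
    case True
    then have "insert i (F - {j}) \<inter> G = shift_set i j (F \<inter> G)"
      using False F by (auto simp: shift_set_def)
    then show ?thesis using F(2) by (simp add: card_shift_set)
  next
    case False
    then show ?thesis using F(2) by (intro card_mono) auto
  qed
  moreover have "t \<le> int (card (F \<inter> G))"
    using cr F(1) G(1) by (simp add: cross_intersecting_def)
  ultimately show ?thesis by linarith
qed

lemma cross_intersecting_shift:
  assumes cr: "cross_intersecting t A B" and fin: "\<And>F. F \<in> A \<union> B \<Longrightarrow> finite F"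
  shows "cross_intersecting t (shift i j A) (shift i j B)"
  unfolding cross_intersecting_def
proof (intro ballI)
  fix F' G' assume "F' \<in> shift i j A" "G' \<in> shift i j B"
  then obtain F G where F: "F \<in> A" "F' = shift_in i j A F" and G: "G \<in> B" "G' = shift_in i j B G"
    by (auto simp: shift_def)
  have finF: "finite F" "finite G" using fin F(1) G(1) by auto
  have base: "t \<le> int (card (F \<inter> G))" using cr F(1) G(1) by (simp add: cross_intersecting_def)
  consider "shift_set i j F \<in> A" "shift_set i j G \<in> B"
    | "shift_set i j F \<notin> A" "shift_set i j G \<in> B"
    | "shift_set i j F \<in> A" "shift_set i j G \<notin> B"
    | "shift_set i j F \<notin> A" "shift_set i j G \<notin> B" by blast
  then show "t \<le> int (card (F' \<inter> G'))"
  proof cases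
    case 1
    then show ?thesis using base F(2) G(2) by (simp add: shift_in_def)
  next
    case 2
    then have "j \<in> F" "i \<notin> F" using F(1) by (auto simp: shift_set_def split: if_splits)
    moreover from this 2 have "F' = insert i (F - {j})" "G' = G"
      using F(2) G(2) by (auto simp: shift_in_def shift_set_def)
    ultimately show ?thesis using moved_meets_unmoved[OF cr F(1) finF(1)] G(1) 2(2) by simp
  next
    case 3
    then have "j \<in> G" "i \<notin> G" using G(1) by (auto simp: shift_set_def split: if_splits)
    moreover from this 3 have "G' = insert i (G - {j})" "F' = F"
      using F(2) G(2) by (auto simp: shift_in_def shift_set_def)
    moreover have "cross_intersecting t B A" using cr by (simp add: cross_intersecting_commute)
    ultimately show ?thesis
      using moved_meets_unmoved[of t B A G j i F] G(1) finF(2) F(1) 3(1) by (simp add: Int_commute)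
  next
    case 4
    then have ij: "j \<in> F" "i \<notin> F" "j \<in> G" "i \<notin> G"
      using F(1) G(1) by (auto simp: shift_set_def split: if_splits)
    then have "F' \<inter> G' = shift_set i j (F \<inter> G)"
      using 4 F(2) G(2) by (auto simp: shift_in_def shift_set_def)
    then show ?thesis using base finF by (simp add: card_shift_set)
  qed
qed

text \<open>A compression towards smaller numbers that changes the family lowers this quantity, so repeated
  compression ends with a shifted family.\<close>

definition weight :: "nat set set \<Rightarrow> nat" where
  "weight A = (\<Sum>F\<in>A. \<Sum>F)"

lemma sum_shift_set_less:
  assumes "finite F" "i < j" "shift_set i j F \<noteq> F"
  shows "\<Sum>(shift_set i j F) < \<Sum>F"
proof -
  have "j \<in> F" "i \<notin> F" using assms(3) by (auto simp: shift_set_def split: if_splits)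
  then have "\<Sum>(shift_set i j F) = i + \<Sum>(F - {j})" "\<Sum>F = j + \<Sum>(F - {j})"
    using assms(1) by (auto simp: shift_set_def sum.remove)
  then show ?thesis using assms(2) by simp
qed

lemma weight_shift: "weight (shift i j A) = (\<Sum>F\<in>A. \<Sum>(shift_in i j A F))"
  unfolding weight_def shift_def by (simp add: sum.reindex[OF inj_on_shift_in])

lemma sum_shift_in_le:
  assumes "finite F" "i < j"
  shows "\<Sum>(shift_in i j A F) \<le> \<Sum>F"
  using sum_shift_set_less[OF assms] by (cases "shift_set i j F = F") (auto simp: shift_in_def)

lemma weight_shift_le:
  assumes "\<And>F. F \<in> A \<Longrightarrow> finite F" "i < j"
  shows "weight (shift i j A) \<le> weight A"
  unfolding weight_shift unfolding weight_def
  using assms by (intro sum_mono sum_shift_in_le) auto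

lemma weight_shift_less:
  assumes "\<And>F. F \<in> A \<Longrightarrow> finite F" "finite A" "i < j"
    and "F \<in> A" "j \<in> F" "i \<notin> F" "insert i (F - {j}) \<notin> A"
  shows "weight (shift i j A) < weight A"
  unfolding weight_shift unfolding weight_def
proof (rule sum_strict_mono_ex1)
  show "\<forall>F\<in>A. \<Sum>(shift_in i j A F) \<le> \<Sum>F" using assms sum_shift_in_le by blast
  have "shift_in i j A F = shift_set i j F" "shift_set i j F \<noteq> F"
    using assms by (auto simp: shift_in_def shift_set_def)
  then show "\<exists>F\<in>A. \<Sum>(shift_in i j A F) < \<Sum>F"
    using sum_shift_set_less[OF assms(1)[OF assms(4)] assms(3)] assms(4) by (intro bexI[of _ F]) simp_all
qed (use assms in auto)

section \<open>Splitting a family at one point\<close>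

definition deletion :: "'a set set \<Rightarrow> 'a \<Rightarrow> 'a set set" where
  "deletion A x = {F \<in> A. x \<notin> F}"

lemma card_link: "card (link A x) = card {F \<in> A. x \<in> F}"
proof -
  have "link A x = (\<lambda>F. F - {x}) ` {F \<in> A. x \<in> F}" by (auto simp: link_def)
  moreover have "inj_on (\<lambda>F. F - {x}) {F \<in> A. x \<in> F}" by (rule inj_onI) blast
  ultimately show ?thesis by (simp add: card_image)
qed

lemma card_link_deletion:
  assumes "finite A" shows "card A = card (link A x) + card (deletion A x)"
proof -
  have "A = {F \<in> A. x \<in> F} \<union> deletion A x" by (auto simp: deletion_def)
  moreover have "card ({F \<in> A. x \<in> F} \<union> deletion A x) = card {F \<in> A. x \<in> F} + card (deletion A x)"
    using assms by (intro card_Un_disjoint) (auto simp: deletion_def)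
  ultimately show ?thesis by (simp add: card_link)
qed

lemma uniform_on_link:
  assumes "uniform_on (insert x X) a A" "x \<notin> X" "finite X"
  shows "uniform_on X (a - 1) (link A x)"
  unfolding uniform_on_def
proof
  fix H assume "H \<in> link A x"
  then obtain F where F: "F \<in> A" "x \<in> F" "H = F - {x}" by (auto simp: link_def)
  then have FX: "F \<subseteq> insert x X" "int (card F) = a" using assms(1) by (auto simp: uniform_on_def)
  then have "finite F" using assms(3) finite_subset by blast
  then have "card F = Suc (card H)" using F by (simp add: card_Suc_Diff1 del: card_Diff_insert)
  then show "H \<subseteq> X \<and> int (card H) = a - 1" using FX F by auto
qed

lemma uniform_on_deletion:
  "uniform_on (insert x X) a A \<Longrightarrow> uniform_on X a (deletion A x)"
  by (auto simp: uniform_on_def deletion_def)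

lemma shifted_on_link:
  assumes "shifted_on (insert x X) A" "x \<notin> X" shows "shifted_on X (link A x)"
  unfolding shifted_on_def
proof (intro ballI impI)
  fix H i j assume *: "H \<in> link A x" "i \<in> X" "j \<in> X" "i < j \<and> j \<in> H \<and> i \<notin> H"
  then obtain F where F: "F \<in> A" "x \<in> F" "H = F - {x}" by (auto simp: link_def)
  have "i \<noteq> x" "j \<noteq> x" using * assms(2) by auto
  then have "insert i (F - {j}) \<in> A" "x \<in> insert i (F - {j})"
    "insert i (H - {j}) = insert i (F - {j}) - {x}"
    using assms(1) * F by (auto simp: shifted_on_def)
  then show "insert i (H - {j}) \<in> link A x" unfolding link_def by blast
qed

lemma shifted_on_deletion:
  assumes "shifted_on (insert x X) A" "x \<notin> X" shows "shifted_on X (deletion A x)"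
  using assms by (auto simp: shifted_on_def deletion_def)

lemma cross_intersecting_link_link:
  assumes "cross_intersecting t A B" "\<And>F. F \<in> A \<Longrightarrow> finite F"
  shows "cross_intersecting (t - 1) (link A x) (link B x)"
  unfolding cross_intersecting_def
proof (intro ballI)
  fix F' G' assume "F' \<in> link A x" "G' \<in> link B x"
  then obtain F G where *: "F \<in> A" "x \<in> F" "F' = F - {x}" "G \<in> B" "x \<in> G" "G' = G - {x}"
    by (auto simp: link_def)
  have "F \<inter> G = insert x (F' \<inter> G')" "x \<notin> F' \<inter> G'" "finite (F' \<inter> G')"
    using * assms(2) by auto
  then have "card (F \<inter> G) = Suc (card (F' \<inter> G'))" by simp
  moreover have "t \<le> int (card (F \<inter> G))"
    using assms(1) * by (auto simp: cross_intersecting_def)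
  ultimately show "t - 1 \<le> int (card (F' \<inter> G'))" by simp
qed

lemma cross_intersecting_link_deletion:
  assumes "cross_intersecting t A B"
  shows "cross_intersecting t (link A x) (deletion B x)"
  unfolding cross_intersecting_def
proof (intro ballI)
  fix F' G assume "F' \<in> link A x" "G \<in> deletion B x"
  then obtain F where *: "F \<in> A" "F' = F - {x}" "G \<in> B" "x \<notin> G"
    by (auto simp: link_def deletion_def)
  then have "F' \<inter> G = F \<inter> G" by auto
  then show "t \<le> int (card (F' \<inter> G))" using assms * by (auto simp: cross_intersecting_def)
qed

text \<open>Shiftedness gains one common point when the least point \<open>x\<close> is avoided: replace a common point \<open>j\<close>
  of \<open>F\<close> and \<open>G\<close> by \<open>x\<close> in \<open>F\<close>. The new set is still in \<open>A\<close>, hence meets \<open>G\<close> in \<open>t\<close> points, none of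
  which is \<open>j\<close>.\<close>

lemma cross_intersecting_deletion_deletion:
  assumes cr: "cross_intersecting t A B" and sh: "shifted_on (insert x X) A"
    and x: "\<And>y. y \<in> X \<Longrightarrow> x < y" and t: "t \<ge> 1"
    and fin: "finite X" and sub: "\<And>F. F \<in> A \<Longrightarrow> F \<subseteq> insert x X"
  shows "cross_intersecting (t + 1) (deletion A x) (deletion B x)"
  unfolding cross_intersecting_def
proof (intro ballI)
  fix F G assume "F \<in> deletion A x" "G \<in> deletion B x"
  then have FG: "F \<in> A" "x \<notin> F" "G \<in> B" "x \<notin> G" by (auto simp: deletion_def)
  have "F \<subseteq> insert x X" using sub FG by simp
  then have finF: "finite F" "F \<subseteq> X" using fin finite_subset FG(2) by auto
  have "t \<le> int (card (F \<inter> G))" using cr FG by (auto simp: cross_intersecting_def)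
  then have "F \<inter> G \<noteq> {}" using t by auto
  then obtain j where j: "j \<in> F" "j \<in> G" by blast
  then have "j \<in> X" "x < j" using finF x by auto
  then have F': "insert x (F - {j}) \<in> A" using sh FG j by (auto simp: shifted_on_def)
  have "t \<le> int (card (insert x (F - {j}) \<inter> G))"
    using cr[unfolded cross_intersecting_def, rule_format, OF F' FG(3)] .
  moreover have "F \<inter> G = insert j (insert x (F - {j}) \<inter> G)" "j \<notin> insert x (F - {j}) \<inter> G"
    using j FG \<open>x < j\<close> by auto
  then have "card (F \<inter> G) = Suc (card (insert x (F - {j}) \<inter> G))"
    using finF by (metis card_insert_disjoint finite_Diff finite_Int finite_insert)
  ultimately show "t + 1 \<le> int (card (F \<inter> G))" by simp
qed

section \<open>Cross-intersecting families\<close>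

text \<open>Pascal's rule in this form has no exceptional case, as the lower index is an integer.\<close>

lemma int_binomial_Suc: "int_binomial (Suc m) j = int_binomial m j + int_binomial m (j - 1)"
proof -
  consider "j < 0" | "j = 0" | "j > 0" by linarith
  then show ?thesis
  proof cases
    case 3
    then have "nat j = Suc (nat (j - 1))" by simp
    then show ?thesis using 3 by (simp add: int_binomial_def)
  qed (auto simp: int_binomial_def)
qed

lemma card_le_int_binomial:
  assumes "finite X" "uniform_on X a A"
  shows "card A \<le> int_binomial (card X) a"
proof (cases "A = {}")
  case False
  then have a: "a \<ge> 0" using assms(2) by (auto simp: uniform_on_def)
  have "card A \<le> card {F. F \<subseteq> X \<and> card F = nat a}"
    using assms by (intro card_mono) (auto simp: uniform_on_def)
  then show ?thesis using a assms(1) by (simp add: int_binomial_def n_subsets)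
qed simp

text \<open>For \<open>2a \<le> m + u\<close> the number \<open>(m choose a-u)\<close> counts, by the reflection principle, the \<open>a\<close>-subsets of
  \<open>{1..m}\<close> having some initial segment \<open>{1..j}\<close> in which the members outnumber the non-members by at
  least \<open>u\<close>. This explains the form of the bound and how it behaves when the least point \<open>x\<close> is removed:
  sets containing \<open>x\<close> still have to gain \<open>u - 1\<close>, sets avoiding it \<open>u + 1\<close>.

  Of the four pairs of links and deletions of \<open>A\<close> and \<open>B\<close>, each is cross-intersecting with exactly
  the parameter needed for its shifted values of \<open>u\<close> and \<open>v\<close>; the pair of deletions requires
  \<open>t + 1\<close>, which is where shiftedness is used. The four resulting disjunctions force both bounds for
  \<open>A\<close> or both bounds for \<open>B\<close>, and these add up by Pascal's rule.\<close>

lemma shifted_cross_intersecting_bound: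
  assumes "finite X"
    and "uniform_on X a A" "uniform_on X b B" "shifted_on X A" "shifted_on X B"
    and "cross_intersecting t A B" "u + v = 2 * t + 1" "u \<ge> 0" "v \<ge> 0"
  shows "card A \<le> int_binomial (card X) (a - u) \<or> card B \<le> int_binomial (card X) (b - v)"
  using assms
proof (induction X arbitrary: A B a b t u v rule: finite_linorder_min_induct)
  case empty
  show ?case
  proof (cases "u = 0 \<or> v = 0")
    case True
    then show ?thesis
      using card_le_int_binomial[OF finite.emptyI empty(1)]
        card_le_int_binomial[OF finite.emptyI empty(2)] by auto
  next
    case False
    then have "t \<ge> 1" using empty by linarith
    have "A = {} \<or> B = {}"
    proof (rule ccontr)
      assume "\<not> (A = {} \<or> B = {})"
      then obtain F G where "F \<in> A" "G \<in> B" by blast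
      then have "F \<inter> G = {}" "t \<le> int (card (F \<inter> G))"
        using empty by (auto simp: uniform_on_def cross_intersecting_def)
      then show False using \<open>t \<ge> 1\<close> by simp
    qed
    then show ?thesis by auto
  qed
next
  case (insert x X)
  have xX: "x \<notin> X" using insert.hyps(2) by auto
  have finX: "finite (insert x X)" using insert.hyps by simp
  note A = insert.prems(1) and B = insert.prems(2)
  note shA = insert.prems(3) and shB = insert.prems(4) and cr = insert.prems(5)
  show ?case
  proof (cases "u = 0 \<or> v = 0")
    case True
    then show ?thesis
      using card_le_int_binomial[OF finX A] card_le_int_binomial[OF finX B] by auto
  next
    case False
    then have uv: "u \<ge> 1" "v \<ge> 1" "t \<ge> 1" using insert.prems by linarith+
    let ?A1 = "link A x" and ?A0 = "deletion A x" and ?B1 = "link B x" and ?B0 = "deletion B x"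
    note un = uniform_on_link[OF A xX insert.hyps(1)] uniform_on_deletion[OF A]
      uniform_on_link[OF B xX insert.hyps(1)] uniform_on_deletion[OF B]
    note sh = shifted_on_link[OF shA xX] shifted_on_deletion[OF shA xX]
      shifted_on_link[OF shB xX] shifted_on_deletion[OF shB xX]
    have subA: "\<And>F. F \<in> A \<Longrightarrow> F \<subseteq> insert x X" using A by (auto simp: uniform_on_def)
    then have finA: "\<And>F. F \<in> A \<Longrightarrow> finite F" using finX finite_subset by blast
    have crBA: "cross_intersecting t B A" using cr by (simp add: cross_intersecting_commute)
    have c11: "cross_intersecting (t - 1) ?A1 ?B1"
      using cross_intersecting_link_link[OF cr finA] by blast
    have c10: "cross_intersecting t ?A1 ?B0" by (rule cross_intersecting_link_deletion[OF cr])
    have c01: "cross_intersecting t ?A0 ?B1"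
      using cross_intersecting_link_deletion[OF crBA] by (simp add: cross_intersecting_commute)
    have c00: "cross_intersecting (t + 1) ?A0 ?B0"
      using cross_intersecting_deletion_deletion[OF cr shA _ uv(3) insert.hyps(1) subA]
        insert.hyps(2) by blast
    let ?m = "card X"
    let ?a1 = "card ?A1 \<le> int_binomial ?m ((a - 1) - (u - 1))"
      and ?a0 = "card ?A0 \<le> int_binomial ?m (a - (u + 1))"
      and ?b1 = "card ?B1 \<le> int_binomial ?m ((b - 1) - (v - 1))"
      and ?b0 = "card ?B0 \<le> int_binomial ?m (b - (v + 1))"
    \<comment> \<open>Four alternatives, one for each pair; \<open>u, v \<ge> 1\<close> keeps \<open>u - 1\<close> and \<open>v - 1\<close> nonnegative.\<close>
    have "?a1 \<or> ?b1"
      using insert.IH[OF un(1) un(3) sh(1) sh(3) c11, of "u - 1" "v - 1"] insert.prems(6) uv by auto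
    moreover have "?a1 \<or> ?b0"
      using insert.IH[OF un(1) un(4) sh(1) sh(4) c10, of "u - 1" "v + 1"] insert.prems(6) uv by auto
    moreover have "?a0 \<or> ?b1"
      using insert.IH[OF un(2) un(3) sh(2) sh(3) c01, of "u + 1" "v - 1"] insert.prems(6) uv by auto
    moreover have "?a0 \<or> ?b0"
      using insert.IH[OF un(2) un(4) sh(2) sh(4) c00, of "u + 1" "v + 1"] insert.prems(6) uv by auto
    \<comment> \<open>If one of the bounds for \<open>A\<close> fails, the two alternatives containing it yield both bounds for \<open>B\<close>.\<close>
    ultimately have "(?a1 \<and> ?a0) \<or> (?b1 \<and> ?b0)" by blast
    moreover have "card A = card ?A1 + card ?A0" "card B = card ?B1 + card ?B0"
      using card_link_deletion[OF uniform_on_finite[OF finX A]]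
        card_link_deletion[OF uniform_on_finite[OF finX B]] by simp_all
    moreover have "int_binomial (card (insert x X)) (a - u)
        = int_binomial ?m ((a - 1) - (u - 1)) + int_binomial ?m (a - (u + 1))"
      "int_binomial (card (insert x X)) (b - v)
        = int_binomial ?m ((b - 1) - (v - 1)) + int_binomial ?m (b - (v + 1))"
      using xX insert.hyps(1) by (simp_all add: int_binomial_Suc algebra_simps)
    ultimately show ?thesis by auto
  qed
qed

lemma cross_intersecting_bound:
  fixes X :: "nat set"
  assumes "finite X"
    and "uniform_on X a A" "uniform_on X b B"
    and "cross_intersecting t A B" "u + v = 2 * t + 1" "u \<ge> 0" "v \<ge> 0"
  shows "card A \<le> int_binomial (card X) (a - u) \<or> card B \<le> int_binomial (card X) (b - v)"
  using assms(2-4)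
proof (induction "weight A + weight B" arbitrary: A B rule: less_induct)
  case less
  have fin: "\<And>F. F \<in> A \<union> B \<Longrightarrow> finite F"
    using less.prems(1,2) assms(1) by (auto simp: uniform_on_def intro: finite_subset)
  have finAB: "finite A" "finite B" using less.prems uniform_on_finite assms(1) by blast+
  show ?case
  proof (cases "shifted_on X A \<and> shifted_on X B")
    case True
    then show ?thesis
      using shifted_cross_intersecting_bound[OF assms(1) less.prems(1,2) _ _ less.prems(3)] assms by blast
  next
    case False
    then obtain i j where ij: "i \<in> X" "i < j"
      and "(\<exists>F\<in>A. j \<in> F \<and> i \<notin> F \<and> insert i (F - {j}) \<notin> A)
        \<or> (\<exists>F\<in>B. j \<in> F \<and> i \<notin> F \<and> insert i (F - {j}) \<notin> B)"
      by (auto simp: shifted_on_def)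
    then have "weight (shift i j A) < weight A \<or> weight (shift i j B) < weight B"
      using weight_shift_less[of A i j] weight_shift_less[of B i j] fin finAB by blast
    moreover have "weight (shift i j A) \<le> weight A" "weight (shift i j B) \<le> weight B"
      using weight_shift_le ij fin by auto
    ultimately have "weight (shift i j A) + weight (shift i j B) < weight A + weight B" by linarith
    from less.hyps[OF this uniform_on_shift uniform_on_shift cross_intersecting_shift]
    show ?thesis using less.prems assms(1) ij fin by (simp add: card_shift)
  qed
qed

section \<open>Families without a dominating element\<close>

text \<open>The link consists of \<open>(k-1)\<close>-sets and the deletion of \<open>k\<close>-sets, so that \<open>u = t\<close> and \<open>v = t + 1\<close> give
  the same lower index \<open>k - t - 1\<close> for both.\<close>

lemma small_link_or_deletion:
  fixes X :: "nat set"
  assumes "finite X" "uniform_on X k A" "cross_intersecting t A A" "t \<ge> 0" "x \<in> X"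
  shows "card (link A x) \<le> int_binomial (card X - 1) (k - t - 1)
    \<or> card (deletion A x) \<le> int_binomial (card X - 1) (k - t - 1)"
proof -
  have X: "insert x (X - {x}) = X" "card (X - {x}) = card X - 1" using assms(1,5) by auto
  have "uniform_on (X - {x}) (k - 1) (link A x)" "uniform_on (X - {x}) k (deletion A x)"
    using uniform_on_link[of x "X - {x}" k A] uniform_on_deletion[of x "X - {x}" k A]
      assms(1,2) X(1) by auto
  from cross_intersecting_bound[OF _ this cross_intersecting_link_deletion[OF assms(3)],
      of t "t + 1"]
  show ?thesis using assms(1,4) X(2) by (simp add: algebra_simps)
qed

text \<open>The deletion is \<open>(t+1)\<close>-intersecting, so the cross-intersecting bound applies to it paired with
  itself, with \<open>u = t + 1\<close> and \<open>v = t + 2\<close>. This leaves two possible bounds, and \<open>2k \<le> |X|\<close> ensures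
  that the one with lower index \<open>k - t - 1\<close> is the larger.\<close>

lemma small_deletion_if_shifted:
  fixes X :: "nat set"
  assumes "finite X" "X \<noteq> {}" "uniform_on X k A" "cross_intersecting t A A" "t \<ge> 1"
    and "shifted_on X A" and "2 * k \<le> int (card X)"
  shows "card (deletion A (Min X)) \<le> int_binomial (card X - 1) (k - t - 1)"
proof -
  let ?x = "Min X" let ?D = "deletion A ?x" let ?m = "card X - 1"
  have x: "?x \<in> X" using assms(1,2) by simp
  have X: "insert ?x (X - {?x}) = X" "card (X - {?x}) = ?m" "finite (X - {?x})"
    using assms(1) x by auto
  have "\<And>y. y \<in> X - {?x} \<Longrightarrow> ?x < y" using assms(1) by (auto simp: order_less_le)
  then have "cross_intersecting (t + 1) ?D ?D"
    using cross_intersecting_deletion_deletion[OF assms(4), of ?x "X - {?x}"] assms(3,5,6) X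
    by (auto simp: uniform_on_def)
  moreover have U: "uniform_on (X - {?x}) k ?D"
    using uniform_on_deletion[of ?x "X - {?x}" k A] assms(3) X(1) by simp
  ultimately have "card ?D \<le> int_binomial ?m (k - (t + 1)) \<or> card ?D \<le> int_binomial ?m (k - (t + 2))"
    using cross_intersecting_bound[OF X(3) U U, of "t + 1" "t + 1" "t + 2"] assms(5) X(2) by simp
  moreover have "int_binomial ?m (k - (t + 2)) \<le> int_binomial ?m (k - (t + 1))"
  proof (cases "k - (t + 2) < 0")
    case False
    then have "nat (k - (t + 2)) \<le> nat (k - (t + 1))" "2 * nat (k - (t + 1)) \<le> ?m"
      using assms(5,7) by linarith+
    then show ?thesis using False by (simp add: int_binomial_def binomial_mono)
  qed (simp add: int_binomial_def)
  ultimately show ?thesis by (auto simp: algebra_simps)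
qed

text \<open>Only sets that contained \<open>j\<close> can acquire a new point.\<close>

lemma card_link_shift_le:
  assumes "finite A"
  shows "card (link (shift i j A) x) \<le> card (link A x) + card (link A j)"
proof -
  have "{H \<in> shift i j A. x \<in> H} \<subseteq> shift_in i j A ` ({F \<in> A. x \<in> F} \<union> {F \<in> A. j \<in> F})"
    by (auto simp: shift_def shift_in_def shift_set_def split: if_splits)
  then have "card {H \<in> shift i j A. x \<in> H} \<le> card ({F \<in> A. x \<in> F} \<union> {F \<in> A. j \<in> F})"
    using assms by (intro surj_card_le) auto
  also have "\<dots> \<le> card {F \<in> A. x \<in> F} + card {F \<in> A. j \<in> F}" by (rule card_Un_le)
  finally show ?thesis by (simp add: card_link)
qed

text \<open>Induction along compressions. In a shifted family the count is \<open>M + M\<close>, for the members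
  containing and those avoiding the least point. Otherwise compress: if the family had more than
  \<open>(t+1) M\<close> members, a degree above \<open>M\<close> in the compressed family would, by the dichotomy, leave at most
  \<open>M\<close> members avoiding the point, while the degree itself is at most \<open>2M\<close>. That accounts for only
  \<open>3M \<le> (t+1) M\<close> members, so the small degrees persist.\<close>

lemma small_links_bound:
  fixes X :: "nat set"
  assumes "finite X" "2 * k \<le> int (card X)" "t \<ge> 2"
    and "uniform_on X k A" "cross_intersecting t A A"
    and "\<And>x. x \<in> X \<Longrightarrow> card (link A x) \<le> int_binomial (card X - 1) (k - t - 1)"
  shows "card A \<le> nat (t + 1) * int_binomial (card X - 1) (k - t - 1)"
  using assms(4-)
proof (induction "weight A" arbitrary: A rule: less_induct)
  case less
  let ?M = "int_binomial (card X - 1) (k - t - 1)"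
  have finA: "finite A" using uniform_on_finite assms(1) less.prems by blast
  have fin: "\<And>F. F \<in> A \<Longrightarrow> finite F"
    using less.prems(1) assms(1) by (auto simp: uniform_on_def intro: finite_subset)
  have t3: "3 * ?M \<le> nat (t + 1) * ?M" using assms(3) by (intro mult_right_mono) auto
  show ?case
  proof (cases "shifted_on X A")
    case True
    show ?thesis
    proof (cases "X = {}")
      case True
      then have "A = {}"
        using less.prems assms(3) by (fastforce simp: uniform_on_def cross_intersecting_def)
      then show ?thesis by simp
    next
      case False
      then have "card (deletion A (Min X)) \<le> ?M"
        using small_deletion_if_shifted[OF assms(1) False less.prems(1,2)] \<open>shifted_on X A\<close> assms
        by simp
      moreover have "card (link A (Min X)) \<le> ?M" using less.prems(3) assms(1) False by simp
      ultimately show ?thesis using card_link_deletion[OF finA, of "Min X"] t3 by linarith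
    qed
  next
    case False
    then obtain i j F where ij: "i \<in> X" "j \<in> X" "i < j"
      and F: "F \<in> A" "j \<in> F" "i \<notin> F" "insert i (F - {j}) \<notin> A"
      by (auto simp: shifted_on_def)
    let ?S = "shift i j A"
    have w: "weight ?S < weight A" using weight_shift_less[OF fin finA ij(3) F] by blast
    have US: "uniform_on X k ?S" by (rule uniform_on_shift[OF less.prems(1) assms(1) ij(1)])
    have CS: "cross_intersecting t ?S ?S"
      using cross_intersecting_shift[OF less.prems(2)] fin by blast
    have finS: "finite ?S" using finA by (simp add: shift_def)
    show ?thesis
    proof (rule ccontr)
      assume neg: "\<not> ?thesis"
      have "card (link ?S x) \<le> ?M" if x: "x \<in> X" for x
      proof (rule ccontr)
        assume "\<not> card (link ?S x) \<le> ?M"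
        then have "card (deletion ?S x) \<le> ?M"
          using small_link_or_deletion[OF assms(1) US CS _ x] assms(3) by auto
        moreover have "card (link ?S x) \<le> 2 * ?M"
          using card_link_shift_le[OF finA, of i j x] less.prems(3)[OF x] less.prems(3)[OF ij(2)]
          by linarith
        ultimately show False
          using card_link_deletion[OF finS, of x] t3 neg card_shift[of i j A] by linarith
      qed
      from less.hyps[OF w US CS this] neg show False by (simp add: card_shift)
    qed
  qed
qed

theorem theorem1p11:
  fixes n k t :: nat and \<F> :: "nat set set"
  assumes "n \<ge> 1" and "k \<ge> 1" and "t \<ge> 2"
    and "\<F> \<subseteq> nsets {1..n} k"
    and "t_intersecting t \<F>"
    and "card \<F> > (t + 1) * int_binomial (n - 1) (int k - int t - 1)"
    and "n \<ge> 2 * t * (t + 2) * k"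
  shows "varrho n \<F> > real t / (real t + 1)"
proof (rule ccontr)
  assume "\<not> ?thesis"
  then have small: "varrho n \<F> \<le> real t / (real t + 1)" by simp
  let ?X = "{1..n}" let ?M = "int_binomial (n - 1) (int k - int t - 1)"
  have U: "uniform_on ?X (int k) \<F>" using assms(4) by (auto simp: uniform_on_def nsets_def)
  have C: "cross_intersecting (int t) \<F> \<F>"
    using assms(5) by (auto simp: cross_intersecting_def t_intersecting_def)
  have finF: "finite \<F>" using uniform_on_finite[OF _ U] by simp
  have pos: "card \<F> > 0" using assms(6) by simp
  have "card (link \<F> x) \<le> ?M" if x: "x \<in> ?X" for x
  proof -
    have "real (card (link \<F> x)) / real (card \<F>) \<le> varrho n \<F>"
      unfolding varrho_def using x by (intro Max_ge) auto
    then have "real (card (link \<F> x)) / real (card \<F>) \<le> real t / (real t + 1)" using small by simp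
    then have "real (card (link \<F> x)) * (real t + 1) \<le> real t * real (card \<F>)"
      using pos by (simp add: field_simps)
    then have "real (card (link \<F> x) * (t + 1)) \<le> real (t * card \<F>)" by (simp add: algebra_simps)
    then have "card (link \<F> x) * (t + 1) \<le> t * card \<F>" using of_nat_le_iff by blast
    \<comment> \<open>A degree of at most \<open>t/(t+1)\<close> of the family leaves a fraction of at least \<open>1/(t+1)\<close> avoiding \<open>x\<close>.\<close>
    then have "card \<F> \<le> (t + 1) * card (deletion \<F> x)"
      using card_link_deletion[OF finF, of x] by (simp add: algebra_simps)
    then have "(t + 1) * ?M < (t + 1) * card (deletion \<F> x)" using assms(6) by linarith
    then have "?M < card (deletion \<F> x)" by (simp only: mult_less_cancel1)
    then show ?thesis using small_link_or_deletion[OF _ U C _ x] by simp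
  qed
  moreover have "2 * k \<le> 2 * t * (t + 2) * k" using assms(3) by (intro mult_right_mono) auto
  then have "2 * k \<le> n" using assms(7) by (rule le_trans)
  ultimately have "card \<F> \<le> nat (int t + 1) * ?M"
    using small_links_bound[OF _ _ _ U C] assms(3) by simp
  moreover have "nat (int t + 1) = t + 1" by simp
  ultimately show False using assms(6) by simp
qed

end
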